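(* Let $\mathfrak{g}$ be a finite-dimensional complex $2$-step nilpotent Lie algebra, let $t\in\mathbb{C}$, and let $\mathfrak{g}\times^{\mathrm{ad}}_t\mathrm{Der}(\mathfrak{g})$ be the deformed Lie algebra corresponding to the crossed module $\mathrm{ad}:\mathfrak{g}\to\mathrm{Der}(\mathfrak{g})$. Then $\mathfrak{g}\times^{\mathrm{ad}}_t\mathrm{Der}(\mathfrak{g})$ is not isomorphic to the direct product Lie algebra $\mathfrak{g}\oplus\mathrm{Der}(\mathfrak{g})$.
   Context: A Lie algebra $\mathfrak{g}$ is $2$-step nilpotent if $[\mathfrak{g},[\mathfrak{g},\mathfrak{g}]]=0$ and $[\mathfrak{g},\mathfrak{g}]\neq 0$. $\mathrm{Der}(\mathfrak{g})$ is the Lie algebra of derivations of $\mathfrak{g}$ (with the commutator bracket), acting on $\mathfrak{g}$ by $D\cdot h=D(h)$. The deformed Lie algebra $\mathfrak{g}\times^{\mathrm{ad}}_t\mathrm{Der}(\mathfrak{g})$ is the vector space $\mathfrak{g}\oplus\mathrm{Der}(\mathfrak{g})$ with bracket $[(h,D),(h',D')]_t=(D(h')-D'(h),[D,D']+t\,\mathrm{ad}_{[h,h']})$. The direct product has bracket $[(h,D),(h',D')]=([h,h'],[D,D'])$. *)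

theory Defs
  imports "HOL-Analysis.Product_Vector" "HOL-Library.Function_Algebras"
begin

(* A Lie algebra is carried by a subspace L of an ambient vector space (a type), and only the
   values of the bracket on L matter.  Subspaces are needed because Der(g) is a subspace of the
   space of all functions g -> g and not a type of its own. *)
locale lie_algebra = vector_space scale
  for scale :: "'k::field \<Rightarrow> 'a::ab_group_add \<Rightarrow> 'a" +
  fixes L :: "'a set" and bracket :: "'a \<Rightarrow> 'a \<Rightarrow> 'a"
  assumes subspace_carrier: "subspace L"
    and bracket_closed: "x \<in> L \<Longrightarrow> y \<in> L \<Longrightarrow> bracket x y \<in> L"
    and bracket_add_left:
      "x \<in> L \<Longrightarrow> y \<in> L \<Longrightarrow> z \<in> L \<Longrightarrow> bracket (x + y) z = bracket x z + bracket y z"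
    and bracket_add_right:
      "x \<in> L \<Longrightarrow> y \<in> L \<Longrightarrow> z \<in> L \<Longrightarrow> bracket x (y + z) = bracket x y + bracket x z"
    and bracket_scale_left:
      "x \<in> L \<Longrightarrow> y \<in> L \<Longrightarrow> bracket (scale c x) y = scale c (bracket x y)"
    and bracket_scale_right:
      "x \<in> L \<Longrightarrow> y \<in> L \<Longrightarrow> bracket x (scale c y) = scale c (bracket x y)"
    and bracket_self: "x \<in> L \<Longrightarrow> bracket x x = 0"
    and jacobi: "x \<in> L \<Longrightarrow> y \<in> L \<Longrightarrow> z \<in> L \<Longrightarrow>
      bracket x (bracket y z) + bracket y (bracket z x) + bracket z (bracket x y) = 0"
begin

definition bracket_space :: "'a set \<Rightarrow> 'a set \<Rightarrow> 'a set" where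
  "bracket_space A B = span {bracket x y | x y. x \<in> A \<and> y \<in> B}"

end

locale two_step_nilpotent_lie_algebra = lie_algebra +
  assumes two_step: "bracket_space L (bracket_space L L) = {0}"
    and nonabelian: "bracket_space L L \<noteq> {0}"

definition lie_isomorphic ::
    "('k \<Rightarrow> 'a::plus \<Rightarrow> 'a) \<Rightarrow> 'a set \<Rightarrow> ('a \<Rightarrow> 'a \<Rightarrow> 'a) \<Rightarrow>
     ('k \<Rightarrow> 'b::plus \<Rightarrow> 'b) \<Rightarrow> 'b set \<Rightarrow> ('b \<Rightarrow> 'b \<Rightarrow> 'b) \<Rightarrow> bool" where
  "lie_isomorphic s1 L1 b1 s2 L2 b2 \<longleftrightarrow>
    (\<exists>\<phi>. bij_betw \<phi> L1 L2 \<and>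
      (\<forall>x\<in>L1. \<forall>y\<in>L1. \<phi> (x + y) = \<phi> x + \<phi> y) \<and>
      (\<forall>c. \<forall>x\<in>L1. \<phi> (s1 c x) = s2 c (\<phi> x)) \<and>
      (\<forall>x\<in>L1. \<forall>y\<in>L1. \<phi> (b1 x y) = b2 (\<phi> x) (\<phi> y)))"

definition fun_scale :: "('k \<Rightarrow> 'b \<Rightarrow> 'b) \<Rightarrow> 'k \<Rightarrow> ('a \<Rightarrow> 'b) \<Rightarrow> 'a \<Rightarrow> 'b" where
  "fun_scale s c f = (\<lambda>x. s c (f x))"

definition derivations ::
    "('k::field \<Rightarrow> 'a::ab_group_add \<Rightarrow> 'a) \<Rightarrow> ('a \<Rightarrow> 'a \<Rightarrow> 'a) \<Rightarrow> ('a \<Rightarrow> 'a) set" where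
  "derivations s b =
    {D. Vector_Spaces.linear s s D \<and> (\<forall>x y. D (b x y) = b (D x) y + b x (D y))}"

definition commutator :: "('a \<Rightarrow> 'a) \<Rightarrow> ('a \<Rightarrow> 'a) \<Rightarrow> 'a \<Rightarrow> 'a::ab_group_add" where
  "commutator D E = (\<lambda>x. D (E x) - E (D x))"

(* The adjoint map ad_x = [x, -] is the bracket b partially applied to x. *)
definition deformed_bracket ::
    "('k \<Rightarrow> 'a::ab_group_add \<Rightarrow> 'a) \<Rightarrow> ('a \<Rightarrow> 'a \<Rightarrow> 'a) \<Rightarrow> 'k \<Rightarrow>
     'a \<times> ('a \<Rightarrow> 'a) \<Rightarrow> 'a \<times> ('a \<Rightarrow> 'a) \<Rightarrow> 'a \<times> ('a \<Rightarrow> 'a)" where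
  "deformed_bracket s b t = (\<lambda>(h, D) (h', D').
     (D h' - D' h, commutator D D' + fun_scale s t (b (b h h'))))"

definition direct_bracket ::
    "('a \<Rightarrow> 'a \<Rightarrow> 'a) \<Rightarrow> ('b \<Rightarrow> 'b \<Rightarrow> 'b) \<Rightarrow> 'a \<times> 'b \<Rightarrow> 'a \<times> 'b \<Rightarrow> 'a \<times> 'b" where
  "direct_bracket b1 b2 = (\<lambda>(x, y) (x', y'). (b1 x x', b2 y y'))"

lemma vector_space_fun_scale:
  assumes "vector_space s"
  shows "vector_space (fun_scale s :: 'k::field \<Rightarrow> ('a \<Rightarrow> 'b::ab_group_add) \<Rightarrow> _)"
proof -
  interpret vector_space s by fact
  show ?thesis
    by unfold_locales
      (auto simp: fun_scale_def fun_eq_iff scale_right_distrib scale_left_distrib)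
qed

lemma lie_algebra_direct_product:
  assumes "lie_algebra s1 L1 b1" and "lie_algebra s2 L2 b2"
  shows "lie_algebra (module_prod.scale s1 s2) (L1 \<times> L2) (direct_bracket b1 b2)"
proof -
  interpret A: lie_algebra s1 L1 b1 by fact
  interpret B: lie_algebra s2 L2 b2 by fact
  interpret P: vector_space_prod s1 s2 by unfold_locales
  show ?thesis
    by unfold_locales
      (use A.jacobi B.jacobi in \<open>auto simp: direct_bracket_def P.scale_prod zero_prod_def
        P.subspace_Times A.subspace_carrier B.subspace_carrier
        A.bracket_closed B.bracket_closed A.bracket_add_left B.bracket_add_left
        A.bracket_add_right B.bracket_add_right A.bracket_scale_left B.bracket_scale_left
        A.bracket_scale_right B.bracket_scale_right A.bracket_self B.bracket_self\<close>)
qed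

locale lie_algebra_type = lie_algebra scale UNIV bracket
  for scale :: "'k::field \<Rightarrow> 'a::ab_group_add \<Rightarrow> 'a" and bracket
begin

lemma bracket_zero_left [simp]: "bracket 0 x = 0"
  using bracket_add_left[of 0 0 x] by simp

lemma bracket_zero_right [simp]: "bracket x 0 = 0"
  using bracket_add_right[of x 0 0] by simp

lemma bracket_anticomm: "bracket x y = - bracket y x"
  using bracket_self[of "x + y"] bracket_self[of x] bracket_self[of y]
  by (simp add: bracket_add_left bracket_add_right add_eq_0_iff)

lemma derivationsD:
  assumes "D \<in> derivations scale bracket"
  shows "D (x + y) = D x + D y" "D (x - y) = D x - D y" "D (scale c x) = scale c (D x)"
    "D (- x) = - D x" "D 0 = 0" "D (bracket x y) = bracket (D x) y + bracket x (D y)"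
proof -
  interpret Vector_Spaces.linear scale scale D using assms by (simp add: derivations_def)
  show "D (x + y) = D x + D y" "D (x - y) = D x - D y" "D (scale c x) = scale c (D x)"
    "D (- x) = - D x" "D 0 = 0" "D (bracket x y) = bracket (D x) y + bracket x (D y)"
    using assms by (auto simp: add scale diff neg zero derivations_def)
qed

lemma derivationsI:
  assumes "\<And>x y. D (x + y) = D x + D y" "\<And>c x. D (scale c x) = scale c (D x)"
    "\<And>x y. D (bracket x y) = bracket (D x) y + bracket x (D y)"
  shows "D \<in> derivations scale bracket"
proof -
  have "Vector_Spaces.linear scale scale D"
    by unfold_locales (simp_all add: assms)
  with assms(3) show ?thesis by (simp add: derivations_def)
qed

lemma bracket_diff_left: "bracket (x - y) z = bracket x z - bracket y z"
  using bracket_add_left[of "x - y" y z] by (simp add: algebra_simps)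

lemma bracket_diff_right: "bracket z (x - y) = bracket z x - bracket z y"
  using bracket_add_right[of z "x - y" y] by (simp add: algebra_simps)

lemma ad_derivation: "bracket x \<in> derivations scale bracket"
proof (rule derivationsI)
  fix y z
  show "bracket x (bracket y z) = bracket (bracket x y) z + bracket y (bracket x z)"
    using jacobi[of x y z] bracket_anticomm[of "bracket x y" z] bracket_anticomm[of z x]
      bracket_diff_right[of y 0 "bracket x z"]
    by (simp add: algebra_simps add_eq_0_iff)
qed (simp_all add: bracket_add_right bracket_scale_right)

lemma subspace_derivations: "module.subspace (fun_scale scale) (derivations scale bracket)"
proof -
  interpret F: vector_space "fun_scale scale :: 'k \<Rightarrow> ('a \<Rightarrow> 'a) \<Rightarrow> _"
    by (rule vector_space_fun_scale) unfold_locales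
  show ?thesis
    unfolding F.subspace_def
    by (auto intro!: derivationsI simp: derivationsD fun_scale_def algebra_simps bracket_add_left
      bracket_add_right bracket_scale_left bracket_scale_right mult.commute)
qed

lemma commutator_derivation:
  assumes "D \<in> derivations scale bracket" "E \<in> derivations scale bracket"
  shows "commutator D E \<in> derivations scale bracket"
  by (rule derivationsI) (simp_all add: commutator_def derivationsD[OF assms(1)]
    derivationsD[OF assms(2)] bracket_diff_left bracket_diff_right algebra_simps)

lemma lie_algebra_derivations:
  "lie_algebra (fun_scale scale) (derivations scale bracket) commutator"
proof -
  interpret F: vector_space "fun_scale scale :: 'k \<Rightarrow> ('a \<Rightarrow> 'a) \<Rightarrow> _"
    by (rule vector_space_fun_scale) unfold_locales
  show ?thesis
    by unfold_locales
      (simp_all add: subspace_derivations commutator_derivation,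
        simp_all add: commutator_def fun_eq_iff derivationsD fun_scale_def algebra_simps)
qed

lemma lie_algebra_deformed:
  "lie_algebra (module_prod.scale scale (fun_scale scale))
     (UNIV \<times> derivations scale bracket) (deformed_bracket scale bracket t)"
proof -
  interpret D: lie_algebra "fun_scale scale" "derivations scale bracket" commutator
    by (rule lie_algebra_derivations)
  interpret P: vector_space_prod scale "fun_scale scale :: 'k \<Rightarrow> ('a \<Rightarrow> 'a) \<Rightarrow> _"
    by unfold_locales
  note simps = deformed_bracket_def P.scale_prod zero_prod_def fun_eq_iff fun_scale_def
    commutator_def derivationsD bracket_add_left bracket_add_right bracket_scale_left
    bracket_scale_right bracket_diff_left bracket_diff_right algebra_simps
  show ?thesis
  proof unfold_locales
    show "P.p.subspace (UNIV \<times> derivations scale bracket)"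
      by (intro P.subspace_Times subspace_UNIV subspace_derivations)
  next
    fix x y :: "'a \<times> ('a \<Rightarrow> 'a)"
    assume "x \<in> UNIV \<times> derivations scale bracket" "y \<in> UNIV \<times> derivations scale bracket"
    then show "deformed_bracket scale bracket t x y \<in> UNIV \<times> derivations scale bracket"
      by (auto simp: deformed_bracket_def intro!: D.subspace_add D.subspace_scale
        subspace_derivations commutator_derivation ad_derivation)
  next
    fix x y z :: "'a \<times> ('a \<Rightarrow> 'a)"
    assume *: "x \<in> UNIV \<times> derivations scale bracket"
      "y \<in> UNIV \<times> derivations scale bracket" "z \<in> UNIV \<times> derivations scale bracket"
    obtain h D h' D' h'' D'' where eq: "x = (h, D)" "y = (h', D')" "z = (h'', D'')"
      by (metis surj_pair)
    with * have d: "D \<in> derivations scale bracket" "D' \<in> derivations scale bracket"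
      "D'' \<in> derivations scale bracket" by auto
    note dd = derivationsD[OF d(1)] derivationsD[OF d(2)] derivationsD[OF d(3)]
    let ?b = "deformed_bracket scale bracket t"
    have m: "bracket (- a) b = - bracket a b" for a b
      using bracket_diff_left[of 0 a b] by simp
    have "bracket (bracket h h') h'' + bracket (bracket h' h'') h + bracket (bracket h'' h) h' = 0"
      using jacobi[of h h' h''] bracket_anticomm[of "bracket h h'" h'']
        bracket_anticomm[of "bracket h' h''" h] bracket_anticomm[of "bracket h'' h" h']
      by (simp add: algebra_simps neg_eq_iff_add_eq_0)
    then have J: "scale t (bracket (bracket h h') h'') + scale t (bracket (bracket h' h'') h)
        + scale t (bracket (bracket h'' h) h') = 0"
      by (simp flip: scale_right_distrib)
    have a: "bracket h (D' h'') = - bracket (D' h'') h" "bracket h (D'' h') = - bracket (D'' h') h"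
      "bracket h' (D h'') = - bracket (D h'') h'" "bracket h' (D'' h) = - bracket (D'' h) h'"
      "bracket h'' (D h') = - bracket (D h') h''" "bracket h'' (D' h) = - bracket (D' h) h''"
      by (rule bracket_anticomm)+
    have "fst (?b x (?b y z) + ?b y (?b z x) + ?b z (?b x y)) =
      - (scale t (bracket (bracket h h') h'') + scale t (bracket (bracket h' h'') h)
        + scale t (bracket (bracket h'' h) h'))"
      by (simp add: eq deformed_bracket_def commutator_def fun_scale_def dd algebra_simps)
    moreover have "snd (?b x (?b y z) + ?b y (?b z x) + ?b z (?b x y)) = 0"
      by (simp add: eq deformed_bracket_def commutator_def fun_scale_def fun_eq_iff dd a m
        bracket_add_left bracket_add_right bracket_diff_left bracket_diff_right
        scale_right_distrib scale_right_diff_distrib algebra_simps)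
    ultimately show "?b x (?b y z) + ?b y (?b z x) + ?b z (?b x y) = 0"
      unfolding J by (simp add: prod_eq_iff)
  qed (auto simp: simps bracket_self)
qed

end

end

theory Submission
  imports Defs
begin

text \<open>
  The two Lie algebras are told apart by their centres. In the direct product, \<open>(z, 0)\<close> is central
  whenever \<open>z\<close> is a commutator, because commutators are central in a 2-step nilpotent algebra; as
  the algebra is not abelian, the centre of the direct product is not zero.

  In the deformed algebra, an element \<open>(h, D)\<close> that commutes with every \<open>(h', 0)\<close> has \<open>D = 0\<close>, and
  an element \<open>(h, 0)\<close> that commutes with every \<open>(0, E)\<close> is killed by all derivations \<open>E\<close>. So the
  centre vanishes as soon as \<open>\<gg>\<close> has a derivation with zero kernel. A 2-step nilpotent algebra has
  one, coming from the grading \<open>\<gg> = W \<oplus> [\<gg>, \<gg>]\<close> with any complement \<open>W\<close>: let it act by \<open>1\<close> on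
  \<open>W\<close> and by \<open>2\<close> on \<open>[\<gg>, \<gg>]\<close>.
\<close>

context lie_algebra_type
begin

lemma bracket_mem_bracket_space:
  "x \<in> A \<Longrightarrow> y \<in> B \<Longrightarrow> bracket x y \<in> bracket_space A B"
  unfolding bracket_space_def by (auto intro!: span_base)

lemma zero_derivation: "0 \<in> derivations scale bracket"
  by (rule derivationsI) simp_all

text \<open>The derivation is \<open>x \<mapsto> x + p x\<close> for a linear projection \<open>p\<close> onto \<open>[\<gg>, \<gg>]\<close>. On a commutator
  it is multiplication by \<open>2\<close>, and the product rule agrees with this because \<open>p\<close> takes central
  values, so that only the two identity terms contribute.\<close>

lemma two_step_injective_derivation:
  assumes central: "bracket_space UNIV (bracket_space UNIV UNIV) = {0}"
    and char: "(2::'k) \<noteq> 0"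
  obtains E where "E \<in> derivations scale bracket" and "\<And>x. E x = 0 \<Longrightarrow> x = 0"
proof -
  define C where "C = bracket_space UNIV UNIV"
  interpret pair: vector_space_pair scale scale by unfold_locales
  have "subspace C" unfolding C_def bracket_space_def by (rule subspace_span)
  then obtain p where p: "range p \<subseteq> C" "Vector_Spaces.linear scale scale p"
      "\<And>c. c \<in> C \<Longrightarrow> p c = c"
    using pair.linear_exists_left_inverse_on[OF linear_id, of C] by auto
  interpret p: Vector_Spaces.linear scale scale p by fact
  have right0: "bracket x (p y) = 0" for x y
    using bracket_mem_bracket_space[of x UNIV "p y" C] p(1) central unfolding C_def by auto
  have left0: "bracket (p x) y = 0" for x y
    using right0[of y x] bracket_anticomm[of "p x" y] by simp
  have p_bracket: "p (bracket x y) = bracket x y" for x y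
    by (rule p(3)) (simp add: C_def bracket_mem_bracket_space)
  show ?thesis
  proof
    show "(\<lambda>x. x + p x) \<in> derivations scale bracket"
      by (rule derivationsI) (simp_all add: p.add p.scale scale_right_distrib p_bracket
        bracket_add_left bracket_add_right left0 right0)
  next
    fix x assume x: "x + p x = 0"
    then have "x = - p x" by (simp add: eq_neg_iff_add_eq_0)
    \<comment> \<open>So \<open>x\<close> lies in \<open>[\<gg>, \<gg>]\<close>, where the map is multiplication by \<open>2\<close>.\<close>
    then have "x \<in> C"
      using p(1) \<open>subspace C\<close> subspace_neg by (metis rangeI subsetD)
    with x p(3) have "scale 2 x = 0"
      using scale_left_distrib[of 1 1 x] by simp
    then show "x = 0" using char by simp
  qed
qed

lemma deformed_centre_trivial:
  assumes E: "E \<in> derivations scale bracket" "\<And>x. E x = 0 \<Longrightarrow> x = 0"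
    and x: "\<And>y. y \<in> UNIV \<times> derivations scale bracket \<Longrightarrow> deformed_bracket scale bracket t x y = 0"
  shows "x = 0"
proof -
  obtain h D where hD: "x = (h, D)" by fastforce
  have "D h' = 0" for h'
    using x[of "(h', 0)"] zero_derivation by (simp add: hD deformed_bracket_def zero_prod_def)
  moreover from this have "E h = 0"
    using x[of "(0, E)"] E(1) by (simp add: hD deformed_bracket_def zero_prod_def)
  ultimately show ?thesis
    using E(2) by (simp add: hD zero_prod_def fun_eq_iff)
qed

end

theorem theorem4p14:
  fixes scale :: "complex \<Rightarrow> 'a::ab_group_add \<Rightarrow> 'a"
    and bracket :: "'a \<Rightarrow> 'a \<Rightarrow> 'a"
    and Basis :: "'a set"
    and t :: complex
  assumes "finite_dimensional_vector_space scale Basis"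
    and "two_step_nilpotent_lie_algebra scale UNIV bracket"
  shows "\<not> lie_isomorphic
      (module_prod.scale scale (fun_scale scale)) (UNIV \<times> derivations scale bracket)
      (deformed_bracket scale bracket t)
      (module_prod.scale scale (fun_scale scale)) (UNIV \<times> derivations scale bracket)
      (direct_bracket bracket commutator)"
proof
  let ?L = "UNIV \<times> derivations scale bracket"
  let ?def = "deformed_bracket scale bracket t"
  let ?dir = "direct_bracket bracket commutator"
  assume "lie_isomorphic (module_prod.scale scale (fun_scale scale)) ?L ?def
    (module_prod.scale scale (fun_scale scale)) ?L ?dir"
  then obtain \<phi> where bij: "bij_betw \<phi> ?L ?L"
    and add: "\<And>x y. x \<in> ?L \<Longrightarrow> y \<in> ?L \<Longrightarrow> \<phi> (x + y) = \<phi> x + \<phi> y"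
    and hom: "\<And>x y. x \<in> ?L \<Longrightarrow> y \<in> ?L \<Longrightarrow> \<phi> (?def x y) = ?dir (\<phi> x) (\<phi> y)"
    unfolding lie_isomorphic_def by blast
  interpret two_step_nilpotent_lie_algebra scale UNIV bracket by fact
  interpret lie_algebra_type scale bracket by unfold_locales
  interpret deformed: lie_algebra "module_prod.scale scale (fun_scale scale)" ?L ?def
    by (rule lie_algebra_deformed)
  have zero: "0 \<in> ?L" using zero_derivation by (simp add: zero_prod_def)
  have \<phi>0: "\<phi> 0 = 0" using add[OF zero zero] by simp
  have "\<exists>a b. bracket a b \<noteq> 0"
  proof (rule ccontr)
    assume "\<not> ?thesis"
    then have "{bracket x y | x y. x \<in> UNIV \<and> y \<in> UNIV} = {0}" by auto
    then show False using nonabelian by (simp add: bracket_space_def)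
  qed
  then obtain a b where nonzero: "bracket a b \<noteq> 0" by blast
  define z where "z = bracket a b"
  have "bracket y z = 0" for y
    using bracket_mem_bracket_space[of y UNIV z "bracket_space UNIV UNIV"]
      bracket_mem_bracket_space[of a UNIV b UNIV] unfolding two_step z_def by simp
  then have z_central: "bracket z y = 0" for y
    using bracket_anticomm[of z y] by simp
  have "(z, 0) \<in> ?L" using zero by (auto simp: zero_prod_def)
  then obtain x where x: "x \<in> ?L" "\<phi> x = (z, 0)"
    using bij_betw_imp_surj_on[OF bij] by (metis (no_types) imageE)
  obtain E where E: "E \<in> derivations scale bracket" "\<And>x. E x = 0 \<Longrightarrow> x = 0"
    by (rule two_step_injective_derivation[OF two_step zero_neq_numeral[symmetric]]) metis
  have x_central: "?def x y = 0" if y: "y \<in> ?L" for y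
  proof -
    obtain k D where kD: "\<phi> y = (k, D)" "D \<in> derivations scale bracket"
      using bij_betw_apply[OF bij y] by fastforce
    have "commutator 0 D = 0"
      using derivationsD(5)[OF kD(2)] by (simp add: commutator_def fun_eq_iff)
    then have "\<phi> (?def x y) = \<phi> 0"
      unfolding hom[OF x(1) y] x(2) kD(1) \<phi>0
      by (simp add: direct_bracket_def z_central zero_prod_def)
    then show ?thesis
      by (rule inj_onD[OF bij_betw_imp_inj_on[OF bij]])
        (rule deformed.bracket_closed[OF x(1) y] zero)+
  qed
  have "x = 0" by (rule deformed_centre_trivial[OF E x_central])
  then show False using x(2) \<phi>0 nonzero by (simp add: z_def zero_prod_def)
qed

end
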